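(* Let $\xi>1/\lambda^+_{\min}(R)$, $\gamma\in(0,1)$ and $s_0\in\mathbb R^n$, and let $(z_j)_{j\ge1}$, $(y_j)_{j\ge1}$, $(s_j)_{j\ge0}$ be sequences generated by the iteration $$z_{j+1}=M_\xi s_j+c_\xi,\qquad y_{j+1}\in\Pi_{\mathcal Z}(s_j),\qquad s_{j+1}=s_j-\gamma W(z_{j+1}-y_{j+1}),\qquad j=0,1,2,\dots$$ If $(y_j,z_j,s_j)$ converges to a point $(y^*,z^*,s^* )$, then $y^*=z^*$ and $z^*$ is a local minimum of the problem $\min_{z\in\mathcal E\cap\mathcal Z}\tfrac12 z^\top Hz+h^\top z$. Moreover, $(z^*,\xi(z^*-s^* ))$ is a regular KKT point.
   Context: Setting: $H\in\mathbb R^{n\times n}$ is (symmetric) positive definite, $h\in\mathbb R^n$. The set $\mathcal Z=\prod_{k=1}^N\big(\bigcup_{i=1}^{m_k}\mathcal Z_{k,i}\big)\subseteq\mathbb R^n$, where $n=\sum_k n_k$ and each $\mathcal Z_{k,i}\subseteq\mathbb R^{n_k}$ is a closed convex polyhedron. The set $\mathcal E=\{z\in\mathbb R^n: Az=b\}=\{Vv+\bar v: v\in\mathbb R^{n-m}\}$, with $A\in\mathbb R^{m\times n}$ of full row rank, $V\in\mathbb R^{n\times(n-m)}$ of full column rank, $\bar v\in\mathbb R^n$. It is assumed that $\mathcal E\cap\mathcal Z\neq\varnothing$. Local minimum: a point $z^*\in\mathcal E\cap\mathcal Z$ minimizing the objective over $\mathcal E\cap\mathcal Z\cap\{z:\|z-z^*\|\le\epsilon\}$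 for some $\epsilon>0$. Projection: $\Pi_{\mathcal Z}(s)=\operatorname{argmin}_{z\in\mathcal Z}\|s-z\|$ (set-valued, Euclidean norm). Regular normal cone of a closed set $\mathcal C$ at $z\in\mathcal C$: $\hat N_{\mathcal C}(z)=\{x:\limsup_{u\to z,\,u\in\mathcal C,\,u\ne z}\langle x,u-z\rangle/\|u-z\|\le0\}$ (empty if $z\notin\mathcal C$). Regular KKT point: a pair $(z,\lambda)\in\mathbb R^n\times\mathbb R^n$ with $0\in\{Hz+h\}+\hat N_{\mathcal E}(z)-\{\lambda\}$ and $0\in\hat N_{\mathcal Z}(z)+\{\lambda\}$. Matrices: $R=V(V^\top HV)^{-1}V^\top$; $\lambda^+_{\min}(R)$ is its smallest non-zero eigenvalue; $M_\xi=\xi(\xi R-I)^{-1}R$; $c_\xi=(\xi R-I)^{-1}(R(h+H\bar v)-\bar v)$. For $\xi>1/\lambda^+_{\min}(R)$ the matrix $M_\xi$ is well defined, symmetric positive semidefinite with $n-m$ positive eigenvalues; write its eigendecomposition $M_\xi=Q\,\mathrm{diag}(\Lambda,0)\,Q^\top$ with $Q$ orthonormal and $\Lambda\in\mathbb R^{(n-m)\times(n-m)}$ diagonal positive definite, and set $W=Q\,\mathrm{diag}(\tfrac12\Lambda^{-1},-I)\,Q^\top$. *)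

theory Defs
  imports "HOL-Analysis.Analysis"
begin

definition pos_def :: "real^'n^'n \<Rightarrow> bool" where
  "pos_def H \<longleftrightarrow> transpose H = H \<and> (\<forall>x. x \<noteq> 0 \<longrightarrow> 0 < x \<bullet> (H *v x))"

definition eigenvalues :: "real^'n^'n \<Rightarrow> real set" where
  "eigenvalues A = {l. \<exists>x. x \<noteq> 0 \<and> A *v x = l *\<^sub>R x}"

(* Meaningful whenever A has a non-zero real eigenvalue; the set of eigenvalues is always finite. *)
definition lambda_min_pos :: "real^'n^'n \<Rightarrow> real" where
  "lambda_min_pos A = Min (eigenvalues A - {0})"

(* The decomposition n = n_1 + ... + n_N is given by blk :: 'n => nat, sending a coordinate to
   the number of its block, so n_k = card {i. blk i = k}.  The factor R^{n_k} is identified with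
   the subspace of R^n of the vectors vanishing outside block k; a polyhedron of that factor is
   then the same thing as a polyhedron of R^n contained in the subspace. *)
definition block_space :: "('n::finite \<Rightarrow> nat) \<Rightarrow> nat \<Rightarrow> (real^'n) set" where
  "block_space blk k = {x. \<forall>i. blk i \<noteq> k \<longrightarrow> x $ i = 0}"

definition block_part :: "('n::finite \<Rightarrow> nat) \<Rightarrow> nat \<Rightarrow> real^'n \<Rightarrow> real^'n" where
  "block_part blk k z = (\<chi> i. if blk i = k then z $ i else 0)"

definition prod_of_unions ::
  "('n::finite \<Rightarrow> nat) \<Rightarrow> nat \<Rightarrow> (nat \<Rightarrow> nat) \<Rightarrow> (nat \<Rightarrow> nat \<Rightarrow> (real^'n) set) \<Rightarrow> (real^'n) set"
where
  "prod_of_unions blk N mk P =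
     {z. \<forall>k\<in>{1..N}. block_part blk k z \<in> (\<Union>i\<in>{1..mk k}. P k i)}"

definition proj_set :: "(real^'n) set \<Rightarrow> real^'n \<Rightarrow> (real^'n) set" where
  "proj_set C s = {z. is_arg_min (\<lambda>w. norm (s - w)) (\<lambda>w. w \<in> C) z}"

definition local_minimum :: "(real^'n \<Rightarrow> real) \<Rightarrow> (real^'n) set \<Rightarrow> real^'n \<Rightarrow> bool" where
  "local_minimum f C z \<longleftrightarrow>
     z \<in> C \<and> (\<exists>e>0. is_arg_min f (\<lambda>w. w \<in> C \<inter> {w. norm (w - z) \<le> e}) z)"

(* At an isolated point of C the filter is trivial and the limsup is -\<infinity>, so the cone is R^n. *)
definition regular_normal_cone :: "(real^'n) set \<Rightarrow> real^'n \<Rightarrow> (real^'n) set" where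
  "regular_normal_cone C z =
     (if z \<in> C
      then {x. Limsup (at z within C) (\<lambda>u. ereal (x \<bullet> (u - z) / norm (u - z))) \<le> 0}
      else {})"

definition quad_obj :: "real^'n^'n \<Rightarrow> real^'n \<Rightarrow> real^'n \<Rightarrow> real" where
  "quad_obj H h z = 1/2 * (z \<bullet> (H *v z)) + h \<bullet> z"

(* The Minkowski sums are spelled out because minus on sets is set difference. *)
definition regular_KKT_point ::
  "real^'n^'n \<Rightarrow> real^'n \<Rightarrow> (real^'n) set \<Rightarrow> (real^'n) set \<Rightarrow> (real^'n) \<times> (real^'n) \<Rightarrow> bool"
where
  "regular_KKT_point H h E Z = (\<lambda>(z, l).
     0 \<in> {H *v z + h + v - l | v. v \<in> regular_normal_cone E z} \<and>
     0 \<in> {v + l | v. v \<in> regular_normal_cone Z z})"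

definition R_mat :: "real^'n^'n \<Rightarrow> real^'p^'n \<Rightarrow> real^'n^'n" where
  "R_mat H V = V ** matrix_inv (transpose V ** H ** V) ** transpose V"

definition M_mat :: "real \<Rightarrow> real^'n^'n \<Rightarrow> real^'n^'n" where
  "M_mat xi R = xi *\<^sub>R (matrix_inv (xi *\<^sub>R R - mat 1) ** R)"

definition c_vec ::
  "real \<Rightarrow> real^'n^'n \<Rightarrow> real^'n^'n \<Rightarrow> real^'n \<Rightarrow> real^'n \<Rightarrow> real^'n" where
  "c_vec xi R H h vbar = matrix_inv (xi *\<^sub>R R - mat 1) *v (R *v (h + H *v vbar) - vbar)"

definition diagonal_mat :: "real^'n^'n \<Rightarrow> bool" where
  "diagonal_mat L \<longleftrightarrow> (\<forall>i j. i \<noteq> j \<longrightarrow> L $ i $ j = 0)"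

definition block_diag :: "real^'p^'p \<Rightarrow> real^'m^'m \<Rightarrow> real^('p::finite + 'm::finite)^('p::finite + 'm::finite)" where
  "block_diag A B = (\<chi> i j. case (i, j) of
       (Inl a, Inl b) \<Rightarrow> A $ a $ b
     | (Inr a, Inr b) \<Rightarrow> B $ a $ b
     | _ \<Rightarrow> 0)"

(* An n x n matrix Q whose columns are indexed by the disjoint union of an index set of size
   n - m and one of size m. *)
definition orthonormal_mat :: "real^'c^'n \<Rightarrow> bool" where
  "orthonormal_mat Q \<longleftrightarrow> transpose Q ** Q = mat 1 \<and> Q ** transpose Q = mat 1"

definition eigendecomposition ::
  "real^'n^'n \<Rightarrow> real^('p::finite + 'm::finite)^'n \<Rightarrow> real^'p^'p \<Rightarrow> bool" where
  "eigendecomposition M Q L \<longleftrightarrow>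
     orthonormal_mat Q \<and> diagonal_mat L \<and> pos_def L \<and>
     M = Q ** block_diag L (0 :: real^'m^'m) ** transpose Q"

definition W_mat :: "real^('p::finite + 'm::finite)^'n \<Rightarrow> real^'p^'p \<Rightarrow> real^'n^'n" where
  "W_mat Q L = Q ** block_diag ((1/2) *\<^sub>R matrix_inv L) (- mat 1 :: real^'m^'m) ** transpose Q"

end

theory Submission
  imports Defs
begin

text \<open>
  Write \<open>\<lambda> = \<xi> (z\<^sup>* - s\<^sup>*)\<close>. Since the increments of a convergent sequence \<open>s\<close> tend to zero and
  \<open>W\<close> is injective, \<open>y\<^sup>* = z\<^sup>*\<close>; and since \<open>Z\<close> is closed, this common point is a projection of
  \<open>s\<^sup>*\<close> onto \<open>Z\<close>. Two descriptions of \<open>z\<^sup>*\<close> follow, one from each half of the iteration.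

  Multiplying \<open>z\<^sup>* = M s\<^sup>* + c\<close> by \<open>\<xi> R - I\<close> gives \<open>z\<^sup>* = R (\<lambda> - h - H v) + v\<close>, with \<open>v\<close> the
  offset of the affine set \<open>E\<close>. As \<open>R\<close> solves the normal equations of the quadratic form \<open>H\<close> on
  the range of \<open>V\<close>, this says that \<open>z\<^sup>*\<close> lies in \<open>E\<close> and that \<open>H z\<^sup>* + h - \<lambda>\<close> is orthogonal to the
  directions of \<open>E\<close> (\<open>affine_step_fixed_point\<close>). The matrix \<open>\<xi> R - I\<close> can be
  cancelled because \<open>R\<close> is symmetric and positive semidefinite, so that \<open>1/\<xi>\<close>, which is positive and
  smaller than every nonzero eigenvalue of \<open>R\<close>, is not an eigenvalue (\<open>R_mat_shift_invertible\<close>).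

  That \<open>z\<^sup>*\<close> is a nearest point of \<open>Z\<close> to \<open>s\<^sup>*\<close> makes \<open>-\<lambda>\<close>, a positive multiple of \<open>s\<^sup>* - z\<^sup>*\<close>, a
  proximal and hence a regular normal of \<open>Z\<close>. Together with the orthogonality this is the KKT
  condition.

  For local minimality, \<open>\<lambda>\<close> must have a nonnegative inner product with \<open>u - z\<^sup>*\<close> for every \<open>u \<in> Z\<close>
  near \<open>z\<^sup>*\<close>, without an error term. This holds because \<open>Z\<close> is built from finitely many closed convex
  pieces: close to \<open>z\<^sup>*\<close> only pieces through \<open>z\<^sup>*\<close> are met, so \<open>Z\<close> contains the segment from \<open>z\<^sup>*\<close> to
  \<open>u\<close> (\<open>prod_of_unions_locally_star_shaped\<close>), and \<open>z\<^sup>*\<close> is the projection of \<open>s\<^sup>*\<close> onto that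
  segment. For \<open>u \<in> E\<close> the linear term of the objective is then the inner product of \<open>\<lambda>\<close> and
  \<open>u - z\<^sup>*\<close>, and the quadratic term is nonnegative.
\<close>

section \<open>Symmetric positive semidefinite matrices\<close>

lemma symmetric_inner:
  fixes H :: "real^'n^'n"
  assumes "transpose H = H"
  shows "x \<bullet> (H *v y) = (H *v x) \<bullet> y"
  using dot_lmul_matrix[of x H y] transpose_matrix_vector[of H x] unfolding assms by simp

text \<open>The form is minimal at a vector where it vanishes, so its gradient \<open>2 B x\<close> is zero there.\<close>

lemma psd_null_vector:
  fixes B :: "real^'n^'n"
  assumes sym: "\<And>x y. x \<bullet> (B *v y) = (B *v x) \<bullet> y"
    and psd: "\<And>x. 0 \<le> x \<bullet> (B *v x)"
    and null: "x \<bullet> (B *v x) = 0"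
  shows "B *v x = 0"
proof (rule ccontr)
  assume nz: "B *v x \<noteq> 0"
  define w where "w = B *v x"
  define a where "a = w \<bullet> w"
  define d where "d = w \<bullet> (B *v w)"
  \<comment> \<open>A step along the negative gradient, short enough for the linear term to dominate;
     the \<open>+ 1\<close> covers \<open>d = 0\<close>.\<close>
  define t where "t = a / (d + 1)"
  have a: "a > 0" using nz by (simp add: a_def w_def)
  have d: "d \<ge> 0" using psd by (simp add: d_def)
  have "0 \<le> (x - t *\<^sub>R w) \<bullet> (B *v (x - t *\<^sub>R w))" by (rule psd)
  also have "(x - t *\<^sub>R w) \<bullet> (B *v (x - t *\<^sub>R w))
      = x \<bullet> w - t * (x \<bullet> (B *v w)) - t * (w \<bullet> w) + t * t * d"
    unfolding matrix_vector_mult_diff_distrib matrix_vector_mult_scaleR d_def w_def[symmetric]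
    by (simp add: inner_diff_left inner_diff_right right_diff_distrib)
  also have "x \<bullet> w = 0" using null by (simp add: w_def)
  also have "x \<bullet> (B *v w) = a" using sym[of x w] by (simp add: a_def w_def)
  also have "0 - t * a - t * (w \<bullet> w) + t * t * d = t * (t * d - 2 * a)"
    by (simp add: a_def right_diff_distrib)
  finally have "0 \<le> t * (t * d - 2 * a)" .
  moreover have "t > 0" using a d by (simp add: t_def)
  moreover have "t * d \<le> a" using a d by (simp add: t_def field_simps)
  ultimately show False using a by (simp add: zero_le_mult_iff)
qed

text \<open>
  The maximum \<open>l\<close> of the Rayleigh quotient is attained at a unit vector \<open>x\<close>. Then \<open>l I - B\<close> is positive
  semidefinite and its form vanishes at \<open>x\<close>, so \<open>x\<close> is an eigenvector for \<open>l\<close>. This is what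
  makes the minimum in the definition of \<open>lambda_min_pos\<close> range over a nonempty set.
\<close>

lemma psd_has_positive_eigenvalue:
  fixes B :: "real^'n^'n"
  assumes sym: "\<And>x y. x \<bullet> (B *v y) = (B *v x) \<bullet> y"
    and psd: "\<And>x. 0 \<le> x \<bullet> (B *v x)"
    and nonzero: "B *v v \<noteq> 0"
  shows "\<exists>l\<in>eigenvalues B. 0 < l"
proof -
  let ?q = "\<lambda>x. x \<bullet> (B *v x)"
  have v: "v \<noteq> 0" using nonzero by auto
  have qv: "?q v > 0"
    using psd[of v] psd_null_vector[OF sym psd] nonzero by (metis less_eq_real_def)
  have "continuous_on (sphere 0 1) ?q"
    by (intro continuous_intros linear_continuous_on) (simp add: linear_linear)
  moreover have "sphere (0::real^'n) 1 \<noteq> {}" by simp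
  ultimately obtain x where x: "x \<in> sphere 0 1" and max: "\<And>y. y \<in> sphere 0 1 \<Longrightarrow> ?q y \<le> ?q x"
    using continuous_attains_sup[OF compact_sphere, of 0 1 ?q] by blast
  define l where "l = ?q x"
  have bound: "?q y \<le> l * (y \<bullet> y)" for y
  proof (cases "y = 0")
    case False
    have "?q (y /\<^sub>R norm y) \<le> l" unfolding l_def using False by (intro max) simp
    moreover have "?q (y /\<^sub>R norm y) = ?q y / (y \<bullet> y)"
      by (simp add: matrix_vector_mult_scaleR dot_square_norm power2_eq_square divide_simps)
    ultimately have "?q y / (y \<bullet> y) \<le> l" by simp
    thus ?thesis using False by (simp add: pos_divide_le_eq)
  qed simp
  have xx: "x \<bullet> x = 1" using x by (simp add: dot_square_norm)
  define D where "D = l *\<^sub>R mat 1 - B"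
  have D: "D *v y = l *\<^sub>R y - B *v y" for y
    by (simp add: D_def matrix_vector_mult_diff_rdistrib scaleR_matrix_vector_assoc[symmetric])
  have "D *v x = 0"
  proof (rule psd_null_vector)
    show "y \<bullet> (D *v w) = (D *v y) \<bullet> w" for y w
      by (simp add: D inner_diff_left inner_diff_right sym)
    show "0 \<le> y \<bullet> (D *v y)" for y using bound[of y] by (simp add: D inner_diff_right)
    show "x \<bullet> (D *v x) = 0" using xx by (simp add: D inner_diff_right l_def)
  qed
  hence eigen: "l \<in> eigenvalues B" using xx by (auto simp: eigenvalues_def D intro!: exI[of _ x])
  have "0 < l * (v \<bullet> v)" using bound[of v] qv by simp
  moreover have "v \<bullet> v > 0" using v by simp
  ultimately have "0 < l" by (rule zero_less_mult_pos2)
  thus ?thesis using eigen by blast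
qed

text \<open>
  Eigenvectors for distinct eigenvalues are orthogonal, hence independent, so the dimension bounds
  their number.
\<close>

lemma finite_eigenvalues_symmetric:
  fixes B :: "real^'n^'n"
  assumes sym: "\<And>x y. x \<bullet> (B *v y) = (B *v x) \<bullet> y"
  shows "finite (eigenvalues B)"
proof -
  have "\<forall>l\<in>eigenvalues B. \<exists>x. x \<noteq> 0 \<and> B *v x = l *\<^sub>R x" by (auto simp: eigenvalues_def)
  then obtain f where f: "\<And>l. l \<in> eigenvalues B \<Longrightarrow> f l \<noteq> 0 \<and> B *v f l = l *\<^sub>R f l"
    unfolding bchoice_iff by blast
  have orth: "f k \<bullet> f l = 0" if "k \<in> eigenvalues B" "l \<in> eigenvalues B" "k \<noteq> l" for k l
    using sym[of "f k" "f l"] f[OF that(1)] f[OF that(2)] that(3) by simp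
  have "pairwise orthogonal (f ` eigenvalues B)"
    unfolding pairwise_def orthogonal_def using orth by blast
  moreover have "0 \<notin> f ` eigenvalues B" using f by force
  ultimately have "finite (f ` eigenvalues B)"
    using pairwise_orthogonal_independent independent_imp_finite by blast
  moreover have "inj_on f (eigenvalues B)"
    by (rule inj_onI) (metis orth f inner_eq_zero_iff)
  ultimately show ?thesis by (rule finite_imageD)
qed

section \<open>The reduced inverse Hessian\<close>

lemma injective_imp_invertible:
  fixes B :: "real^'n^'n"
  assumes "\<And>x. B *v x = 0 \<Longrightarrow> x = 0"
  shows "invertible B"
  using assms by (simp add: invertible_left_inverse matrix_left_invertible_ker)

lemma matrix_inv_vector:
  fixes B :: "real^'n^'n"
  assumes "invertible B"
  shows "B *v (matrix_inv B *v x) = x"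
proof -
  have "B ** matrix_inv B = mat 1"
    using assms unfolding invertible_def matrix_inv_def by (rule someI2_ex) simp
  thus ?thesis by (simp add: matrix_vector_mul_assoc)
qed

lemma pos_def_imp_invertible:
  assumes "pos_def B"
  shows "invertible B"
  using assms by (intro injective_imp_invertible) (auto simp: pos_def_def)

lemma pos_def_congruence:
  fixes H :: "real^'n^'n" and V :: "real^'p^'n"
  assumes H: "pos_def H" and V: "rank V = CARD('p)"
  shows "pos_def (transpose V ** H ** V)"
  unfolding pos_def_def
proof (intro conjI allI impI)
  show "transpose (transpose V ** H ** V) = transpose V ** H ** V"
    using H by (simp add: pos_def_def matrix_transpose_mul matrix_mul_assoc)
  fix x :: "real^'p" assume "x \<noteq> 0"
  hence "V *v x \<noteq> 0"
    using V full_rank_injective[of V] by (metis injD matrix_vector_mult_0_right)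
  moreover have "x \<bullet> ((transpose V ** H ** V) *v x) = (V *v x) \<bullet> (H *v (V *v x))"
    by (metis dot_lmul_matrix matrix_vector_mul_assoc transpose_matrix_vector inner_commute)
  ultimately show "0 < x \<bullet> ((transpose V ** H ** V) *v x)" using H by (simp add: pos_def_def)
qed

text \<open>
  The vector \<open>R x\<close> minimizes \<open>1/2 y \<bullet> H y - x \<bullet> y\<close> over the range of \<open>V\<close>; the two conclusions are
  the optimality conditions of this problem.
\<close>

lemma R_mat_normal_equation:
  fixes H :: "real^'n^'n" and V :: "real^'p^'n"
  assumes "pos_def H" and "rank V = CARD('p)"
  obtains w where "R_mat H V *v x = V *v w"
    and "transpose V *v (H *v (R_mat H V *v x)) = transpose V *v x"
proof
  let ?K = "transpose V ** H ** V"
  let ?w = "matrix_inv ?K *v (transpose V *v x)"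
  show R: "R_mat H V *v x = V *v ?w"
    by (simp add: R_mat_def matrix_vector_mul_assoc matrix_mul_assoc del: transpose_matrix_vector)
  have "?K *v ?w = transpose V *v x"
    by (intro matrix_inv_vector pos_def_imp_invertible pos_def_congruence assms)
  thus "transpose V *v (H *v (R_mat H V *v x)) = transpose V *v x"
    unfolding R by (simp add: matrix_vector_mul_assoc matrix_mul_assoc del: transpose_matrix_vector)
qed

text \<open>
  Testing the normal equation of \<open>R x\<close> with \<open>R y\<close>, an element of the range of \<open>V\<close>. The identity
  \<open>R = R\<^sup>T H R\<close> obtained in this way yields at once that \<open>R\<close> is symmetric and positive semidefinite.
\<close>

lemma R_mat_energy:
  fixes H :: "real^'n^'n" and V :: "real^'p^'n"
  assumes "pos_def H" and "rank V = CARD('p)"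
  shows "x \<bullet> (R_mat H V *v y) = (H *v (R_mat H V *v x)) \<bullet> (R_mat H V *v y)"
proof -
  obtain w where w: "R_mat H V *v y = V *v w"
    using R_mat_normal_equation[OF assms] by blast
  have adj: "u \<bullet> (V *v w) = (transpose V *v u) \<bullet> w" for u
    by (simp add: dot_lmul_matrix transpose_matrix_vector)
  have "transpose V *v (H *v (R_mat H V *v x)) = transpose V *v x"
    using R_mat_normal_equation[OF assms] by blast
  thus ?thesis unfolding w adj by (simp only:)
qed

text \<open>
  A null vector of \<open>\<xi> R - I\<close> would be an eigenvector of \<open>R\<close> for the eigenvalue \<open>1/\<xi>\<close>, below the
  smallest nonzero one. Two facts give \<open>Min\<close> its meaning here: the nonzero eigenvalues form a
  finite nonempty set, and all of them are positive, so that \<open>\<xi>\<close> is positive as well.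
\<close>

lemma R_mat_shift_invertible:
  fixes H :: "real^'n^'n" and V :: "real^'p^'n"
  assumes H: "pos_def H" and V: "rank V = CARD('p)"
    and xi: "xi > 1 / lambda_min_pos (R_mat H V)"
  shows "invertible (xi *\<^sub>R R_mat H V - mat 1)" and "0 < xi"
proof -
  let ?R = "R_mat H V"
  note energy = R_mat_energy[OF H V]
  have symH: "transpose H = H" using H by (simp add: pos_def_def)
  have sym: "x \<bullet> (?R *v y) = (?R *v x) \<bullet> y" for x y
  proof -
    have "x \<bullet> (?R *v y) = (H *v (?R *v x)) \<bullet> (?R *v y)" by (rule energy)
    also have "\<dots> = (?R *v x) \<bullet> (H *v (?R *v y))" by (rule symmetric_inner[OF symH, symmetric])
    also have "\<dots> = (H *v (?R *v y)) \<bullet> (?R *v x)" by (rule inner_commute)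
    also have "\<dots> = y \<bullet> (?R *v x)" by (rule energy[symmetric])
    finally show ?thesis by (simp only: inner_commute)
  qed
  have psd: "0 \<le> x \<bullet> (?R *v x)" for x
  proof (cases "?R *v x = 0")
    case False
    hence "0 < (?R *v x) \<bullet> (H *v (?R *v x))" using H unfolding pos_def_def by blast
    thus ?thesis unfolding energy[of x x] by (simp only: inner_commute less_imp_le)
  qed simp
  have pos: "0 < l" if ev: "l \<in> eigenvalues ?R - {0}" for l
  proof -
    obtain x where "x \<noteq> 0" "?R *v x = l *\<^sub>R x"
      using ev unfolding eigenvalues_def by blast
    hence "0 \<le> l * (x \<bullet> x)" "0 < x \<bullet> x" using psd[of x] by simp_all
    hence "0 \<le> l" by (simp add: zero_le_mult_iff)
    thus ?thesis using ev by simp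
  qed
  define e where "e = V *v 1"
  have "inj ((*v) V)" using V full_rank_injective[of V] by blast
  hence "e \<noteq> 0"
    unfolding e_def using inj_eq[of "(*v) V" 1 0] matrix_vector_mult_0_right[of V] by simp
  \<comment> \<open>\<open>R\<close> is not zero, because \<open>R H\<close> is the \<open>H\<close>-orthogonal projection onto the range of \<open>V\<close>.\<close>
  have "?R *v (H *v e) \<noteq> 0"
  proof
    assume "?R *v (H *v e) = 0"
    hence "(H *v e) v* V = 0"
      using R_mat_normal_equation[OF H V, of "H *v e"]
      by (simp only: matrix_vector_mult_0_right transpose_matrix_vector) simp
    hence "(H *v e) \<bullet> e = 0"
      unfolding e_def dot_lmul_matrix[symmetric] by simp
    moreover have "0 < e \<bullet> (H *v e)" using H \<open>e \<noteq> 0\<close> unfolding pos_def_def by blast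
    ultimately show False by (simp only: inner_commute)
  qed
  then obtain l where "l \<in> eigenvalues ?R" "0 < l"
    using psd_has_positive_eigenvalue[OF sym psd] by blast
  hence l: "l \<in> eigenvalues ?R - {0}" by simp
  have fin: "finite (eigenvalues ?R - {0})" using finite_eigenvalues_symmetric[OF sym] by simp
  have lmin: "lambda_min_pos ?R > 0"
    unfolding lambda_min_pos_def using l fin by (intro pos Min_in) auto
  have "0 < 1 / lambda_min_pos ?R" using lmin by simp
  with xi show xi0: "0 < xi" by linarith
  show "invertible (xi *\<^sub>R ?R - mat 1)"
  proof (rule injective_imp_invertible, rule ccontr)
    fix x assume "(xi *\<^sub>R ?R - mat 1) *v x = 0" and x: "x \<noteq> 0"
    hence "x = xi *\<^sub>R (?R *v x)"
      by (simp add: matrix_vector_mult_diff_rdistrib scaleR_matrix_vector_assoc)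
    hence "(1 / xi) *\<^sub>R x = (1 / xi) *\<^sub>R (xi *\<^sub>R (?R *v x))" by simp
    hence "?R *v x = (1 / xi) *\<^sub>R x" using xi0 by simp
    hence "1 / xi \<in> eigenvalues ?R - {0}" using x xi0 by (auto simp: eigenvalues_def)
    hence "lambda_min_pos ?R \<le> 1 / xi" unfolding lambda_min_pos_def using fin by simp
    thus False using xi xi0 lmin by (simp add: field_simps)
  qed
qed

text \<open>
  Multiplying the equation by \<open>\<xi> R - I\<close> turns it into \<open>z = R (\<xi> (z - s) - h - H vbar) + vbar\<close>, and
  the normal equation of \<open>R\<close> then gives feasibility and stationarity of \<open>z\<close> on the affine set, with
  multiplier \<open>\<xi> (z - s)\<close>.
\<close>

lemma affine_step_fixed_point:
  fixes H :: "real^'n^'n" and V :: "real^'p^'n"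
  assumes H: "pos_def H" and V: "rank V = CARD('p)"
    and xi: "xi > 1 / lambda_min_pos (R_mat H V)"
    and z: "z = M_mat xi (R_mat H V) *v s + c_vec xi (R_mat H V) H h vbar"
  shows "\<exists>w. z = V *v w + vbar"
    and "transpose V *v (H *v z + h - xi *\<^sub>R (z - s)) = 0"
proof -
  let ?R = "R_mat H V"
  let ?S = "xi *\<^sub>R ?R - mat 1"
  let ?r = "xi *\<^sub>R (z - s) - h - H *v vbar"
  let ?q = "?R *v (h + H *v vbar)"
  have "z = matrix_inv ?S *v (xi *\<^sub>R (?R *v s) + (?q - vbar))"
    unfolding z M_mat_def c_vec_def
    by (simp only: matrix_vector_right_distrib matrix_vector_mult_scaleR
        scaleR_matrix_vector_assoc[symmetric] matrix_vector_mul_assoc[symmetric])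
  hence "?S *v z = xi *\<^sub>R (?R *v s) + (?q - vbar)"
    using matrix_inv_vector[OF R_mat_shift_invertible(1)[OF H V xi]] by metis
  moreover have "?S *v z = xi *\<^sub>R (?R *v z) - z"
    by (simp only: matrix_vector_mult_diff_rdistrib scaleR_matrix_vector_assoc[symmetric]
        matrix_vector_mul_lid)
  moreover have "?R *v ?r = xi *\<^sub>R (?R *v z) - xi *\<^sub>R (?R *v s) - ?q"
    by (simp only: matrix_vector_mult_diff_distrib matrix_vector_right_distrib
        matrix_vector_mult_scaleR scaleR_right_diff_distrib diff_diff_add add.assoc)
  ultimately have "?R *v ?r = z - vbar" by (simp add: eq_diff_eq diff_eq_eq add.commute)
  hence zR: "z = ?R *v ?r + vbar" by simp
  obtain w where w: "?R *v ?r = V *v w"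
    and normal: "transpose V *v (H *v (?R *v ?r)) = transpose V *v ?r"
    using R_mat_normal_equation[OF H V] by blast
  show "\<exists>w. z = V *v w + vbar" using zR w by auto
  have "H *v z = H *v (?R *v ?r) + H *v vbar"
    using zR by (metis matrix_vector_right_distrib)
  hence "H *v z + h - xi *\<^sub>R (z - s) = H *v (?R *v ?r) - ?r" by simp
  moreover have "transpose V *v (H *v (?R *v ?r) - ?r) = 0"
    using normal unfolding matrix_vector_mult_diff_distrib[of "transpose V" "H *v (?R *v ?r)"]
    by (simp only: diff_self)
  ultimately show "transpose V *v (H *v z + h - xi *\<^sub>R (z - s)) = 0" by (simp only:)
qed

section \<open>The scaling matrix\<close>

lemma block_diag_mult:
  fixes A :: "real^'p^'p" and B :: "real^'m^'m" and u :: "real^('p::finite + 'm::finite)"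
  shows "(block_diag A B *v u) $ Inl i = (A *v (\<chi> j. u $ Inl j)) $ i"
    and "(block_diag A B *v u) $ Inr k = (B *v (\<chi> j. u $ Inr j)) $ k"
proof -
  have split: "sum f (UNIV :: ('p + 'm) set)
      = (\<Sum>j\<in>UNIV. f (Inl j)) + (\<Sum>j\<in>UNIV. f (Inr j))" for f :: "'p + 'm \<Rightarrow> real"
    using sum.Plus[of UNIV UNIV f] unfolding o_def UNIV_Plus_UNIV by (metis finite)
  show "(block_diag A B *v u) $ Inl i = (A *v (\<chi> j. u $ Inl j)) $ i"
    unfolding matrix_vector_mult_def block_diag_def vec_lambda_beta split by simp
  show "(block_diag A B *v u) $ Inr k = (B *v (\<chi> j. u $ Inr j)) $ k"
    unfolding matrix_vector_mult_def block_diag_def vec_lambda_beta split by simp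
qed

text \<open>
  In the orthonormal basis \<open>Q\<close> the matrix \<open>W\<close> acts separately on two blocks, by an invertible
  matrix on each.
\<close>

lemma W_mat_injective:
  fixes Q :: "real^('p::finite + 'm::finite)^'n" and L :: "real^'p^'p"
  assumes Q: "orthonormal_mat Q" and L: "pos_def L" and Wx: "W_mat Q L *v x = 0"
  shows "x = 0"
proof -
  define u where "u = transpose Q *v x"
  define B where "B = block_diag ((1/2) *\<^sub>R matrix_inv L) (- mat 1 :: real^'m^'m)"
  have QQ: "transpose Q *v (Q *v w) = w" "Q *v (transpose Q *v v) = v" for w v
    using Q unfolding orthonormal_mat_def
    by (simp_all add: matrix_vector_mul_assoc del: transpose_matrix_vector)
  have "W_mat Q L *v x = Q *v (B *v u)"
    unfolding W_mat_def B_def u_def by (simp only: matrix_vector_mul_assoc matrix_mul_assoc)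
  hence Bu: "B *v u = 0" using Wx QQ(1)[of "B *v u"] by simp
  define ul :: "real^'p" where "ul = (\<chi> i. u $ Inl i)"
  define ur :: "real^'m" where "ur = (\<chi> i. u $ Inr i)"
  have "(((1/2) *\<^sub>R matrix_inv L) *v ul) $ i = (B *v u) $ Inl i" for i
    by (simp only: ul_def B_def block_diag_mult)
  hence "((1/2) *\<^sub>R matrix_inv L) *v ul = 0" using Bu by (simp add: vec_eq_iff)
  hence "matrix_inv L *v ul = 0" by (simp add: scaleR_matrix_vector_assoc[symmetric])
  hence "ul = 0"
    using matrix_inv_vector[OF pos_def_imp_invertible[OF L], of ul] by simp
  have "((- mat 1 :: real^'m^'m) *v ur) $ i = (B *v u) $ Inr i" for i
    by (simp only: ur_def B_def block_diag_mult)
  hence "(- mat 1 :: real^'m^'m) *v ur = 0" using Bu by (simp add: vec_eq_iff)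
  moreover have "(- mat 1 :: real^'m^'m) *v ur = - ur"
    using matrix_vector_mult_diff_rdistrib[of 0 "mat 1 :: real^'m^'m" ur] by simp
  ultimately have "ur = 0" by simp
  have "u $ i = 0" for i
    using \<open>ul = 0\<close> \<open>ur = 0\<close> by (cases i) (auto simp: ul_def ur_def vec_eq_iff)
  hence "u = 0" by (simp add: vec_eq_iff)
  thus "x = 0" using QQ(2)[of x] by (simp add: u_def)
qed

section \<open>Projections onto unions of polyhedra\<close>

lemma linear_block_part: "linear (block_part blk k)"
  by (rule linearI) (auto simp: block_part_def vec_eq_iff)

lemma continuous_block_part: "continuous_on S (block_part blk k)"
  by (intro linear_continuous_on linear_conv_bounded_linear[THEN iffD1] linear_block_part)

lemma closed_prod_of_unions:
  assumes P: "\<And>k i. k \<in> {1..N} \<Longrightarrow> i \<in> {1..mk k} \<Longrightarrow> closed (P k i)"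
  shows "closed (prod_of_unions blk N mk P)"
proof -
  have "prod_of_unions blk N mk P
      = (\<Inter>k\<in>{1..N}. block_part blk k -` (\<Union>i\<in>{1..mk k}. P k i))"
    by (auto simp: prod_of_unions_def)
  also have "closed \<dots>"
    using P by (intro closed_INT ballI closed_vimage closed_UN continuous_block_part) auto
  finally show ?thesis .
qed

text \<open>
  A closed piece missing the corresponding block of \<open>z\<close> stays away from it, so by finiteness every
  piece used by a point \<open>u\<close> close to \<open>z\<close> also contains the block of \<open>z\<close>. Convexity of the chosen
  pieces puts the segment into the set, block by block. The radius is halved because the
  neighbourhood is an open ball and the bound in the conclusion is not strict.
\<close>

lemma prod_of_unions_locally_star_shaped:
  assumes P: "\<And>k i. k \<in> {1..N} \<Longrightarrow> i \<in> {1..mk k} \<Longrightarrow> closed (P k i) \<and> convex (P k i)"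
  shows "\<exists>e>0. \<forall>u\<in>prod_of_unions blk N mk P. norm (u - z) \<le> e \<longrightarrow>
           closed_segment z u \<subseteq> prod_of_unions blk N mk P"
proof -
  let ?B = "block_part blk"
  have stay: "\<forall>\<^sub>F u in nhds z. ?B k u \<in> P k i \<longrightarrow> ?B k z \<in> P k i"
    if k: "k \<in> {1..N}" and i: "i \<in> {1..mk k}" for k i
  proof (cases "?B k z \<in> P k i")
    case False
    have "open (?B k -` (- P k i))"
      using P[OF k i] by (intro open_vimage open_Compl continuous_block_part) simp
    hence "\<forall>\<^sub>F u in nhds z. u \<in> ?B k -` (- P k i)" using False by (intro eventually_nhds_in_open) auto
    thus ?thesis by eventually_elim auto
  qed simp
  have "\<forall>\<^sub>F u in nhds z. \<forall>k\<in>{1..N}. \<forall>i\<in>{1..mk k}. ?B k u \<in> P k i \<longrightarrow> ?B k z \<in> P k i"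
    by (intro eventually_ball_finite ballI stay) auto
  then obtain d where d: "d > 0"
    and near: "\<And>u k i. dist u z < d \<Longrightarrow> k \<in> {1..N} \<Longrightarrow> i \<in> {1..mk k} \<Longrightarrow>
                 ?B k u \<in> P k i \<Longrightarrow> ?B k z \<in> P k i"
    unfolding eventually_nhds_metric by blast
  have "closed_segment z u \<subseteq> prod_of_unions blk N mk P"
    if u: "u \<in> prod_of_unions blk N mk P" and un: "norm (u - z) \<le> d / 2" for u
  proof
    fix v assume v: "v \<in> closed_segment z u"
    have "\<exists>i\<in>{1..mk k}. ?B k v \<in> P k i" if k: "k \<in> {1..N}" for k
    proof -
      obtain i where i: "i \<in> {1..mk k}" and ui: "?B k u \<in> P k i"
        using u k unfolding prod_of_unions_def by blast
      have "dist u z < d" using un d by (simp add: dist_norm)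
      hence zi: "?B k z \<in> P k i" using near k i ui by blast
      have "?B k v \<in> closed_segment (?B k z) (?B k u)"
        using v closed_segment_linear_image[OF linear_block_part, of blk k z u] by blast
      thus ?thesis using i ui zi P[OF k i] closed_segment_subset by blast
    qed
    thus "v \<in> prod_of_unions blk N mk P" by (simp add: prod_of_unions_def)
  qed
  thus ?thesis using half_gt_zero[OF d] by blast
qed

lemma mem_proj_set_iff: "z \<in> proj_set C s \<longleftrightarrow> z \<in> C \<and> (\<forall>w\<in>C. norm (s - z) \<le> norm (s - w))"
  unfolding proj_set_def is_arg_min_def mem_Collect_eq not_ex de_Morgan_conj not_less by blast

lemma proj_set_limit:
  assumes "closed C" and y: "\<And>j. y j \<in> proj_set C (s j)"
    and "y \<longlonglongrightarrow> y0" and "s \<longlonglongrightarrow> s0"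
  shows "y0 \<in> proj_set C s0"
  unfolding mem_proj_set_iff
proof (intro conjI ballI)
  have "\<forall>j. y j \<in> C" using y unfolding mem_proj_set_iff by blast
  thus "y0 \<in> C" using closed_sequentially assms(1,3) by blast
next
  fix w assume w: "w \<in> C"
  show "norm (s0 - y0) \<le> norm (s0 - w)"
  proof (rule LIMSEQ_le)
    show "(\<lambda>j. norm (s j - y j)) \<longlonglongrightarrow> norm (s0 - y0)" by (intro tendsto_intros assms)
    show "(\<lambda>j. norm (s j - w)) \<longlonglongrightarrow> norm (s0 - w)" by (intro tendsto_intros assms)
    show "\<exists>n. \<forall>j\<ge>n. norm (s j - y j) \<le> norm (s j - w)"
      using y w unfolding mem_proj_set_iff by blast
  qed
qed

text \<open>
  The point \<open>z\<close> is also the projection of \<open>s\<close> onto the segment, where the obtuse angle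
  criterion for convex sets applies although \<open>C\<close> itself may be nonconvex.
\<close>

lemma proj_set_segment_obtuse:
  assumes z: "z \<in> proj_set C s" and seg: "closed_segment z u \<subseteq> C"
  shows "(s - z) \<bullet> (u - z) \<le> 0"
proof (rule any_closest_point_dot[OF convex_closed_segment closed_segment])
  show "\<forall>v\<in>closed_segment z u. dist s z \<le> dist s v"
    using assms unfolding mem_proj_set_iff dist_norm by blast
qed (rule ends_in_segment)+

text \<open>
  For an arbitrary set the obtuse angle criterion survives up to a second order error, which
  is what remains after squaring and expanding \<open>norm (s - z) \<le> norm (s - u)\<close>.
\<close>

lemma proj_set_proximal:
  assumes z: "z \<in> proj_set C s" and u: "u \<in> C"
  shows "(s - z) \<bullet> (u - z) \<le> (1/2) * (norm (u - z))\<^sup>2"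
proof -
  have "norm (s - z) \<le> norm (s - u)"
    using assms unfolding mem_proj_set_iff by blast
  hence "(norm (s - z))\<^sup>2 \<le> (norm ((s - z) - (u - z)))\<^sup>2" by (simp add: power_mono)
  thus ?thesis
    by (simp add: power2_norm_eq_inner inner_diff_left inner_diff_right inner_commute)
qed

text \<open>A second order error disappears after division by \<open>norm (u - z)\<close>.\<close>

lemma regular_normal_coneI_proximal:
  assumes z: "z \<in> C" and prox: "\<And>u. u \<in> C \<Longrightarrow> x \<bullet> (u - z) \<le> c * (norm (u - z))\<^sup>2"
  shows "x \<in> regular_normal_cone C z"
proof -
  have "Limsup (at z within C) (\<lambda>u. ereal (x \<bullet> (u - z) / norm (u - z))) \<le> 0"
    unfolding Limsup_le_iff
  proof (intro allI impI)
    fix y :: ereal assume y: "0 < y"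
    have "((\<lambda>u. ereal (c * norm (u - z))) \<longlongrightarrow> ereal (c * norm (z - z))) (at z within C)"
      by (intro tendsto_intros)
    hence "\<forall>\<^sub>F u in at z within C. ereal (c * norm (u - z)) < y"
      by (rule order_tendstoD(2)) (use y in \<open>simp add: zero_ereal_def\<close>)
    moreover have "\<forall>\<^sub>F u in at z within C. u \<in> C \<and> u \<noteq> z"
      by (auto simp: eventually_at_filter)
    ultimately show "\<forall>\<^sub>F u in at z within C. ereal (x \<bullet> (u - z) / norm (u - z)) < y"
    proof eventually_elim
      case (elim u)
      have "x \<bullet> (u - z) / norm (u - z) \<le> c * norm (u - z)"
        using prox[of u] elim(2) by (simp add: divide_le_eq power2_eq_square mult.assoc)
      thus ?case using elim(1) by (meson ereal_less_eq(3) le_less_trans)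
    qed
  qed
  thus ?thesis using z by (simp add: regular_normal_cone_def)
qed

section \<open>Limits of the iteration\<close>

lemma quad_obj_expand:
  assumes "transpose H = H"
  shows "quad_obj H h u = quad_obj H h z + (H *v z + h) \<bullet> (u - z)
           + 1/2 * ((u - z) \<bullet> (H *v (u - z)))"
proof -
  define d where "d = u - z"
  have u: "u = z + d" by (simp add: d_def)
  have cross: "z \<bullet> (H *v d) = (H *v z) \<bullet> d" "d \<bullet> (H *v z) = (H *v z) \<bullet> d"
    by (rule symmetric_inner[OF assms], rule inner_commute)
  show ?thesis
    unfolding quad_obj_def d_def[symmetric]
    unfolding u matrix_vector_right_distrib inner_add_left inner_add_right cross
    by (simp add: field_simps)
qed

theorem theorem4p2:
  fixes H :: "real^'n^'n" and h :: "real^'n"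
    and A :: "real^'n^'m" and b :: "real^'m"
    and V :: "real^'p^'n" and vbar :: "real^'n"
    and blk :: "'n \<Rightarrow> nat" and N :: nat and mk :: "nat \<Rightarrow> nat"
    and P :: "nat \<Rightarrow> nat \<Rightarrow> (real^'n) set"
    and E Z :: "(real^'n) set"
    and R M W :: "real^'n^'n" and c :: "real^'n"
    and Q :: "real^('p::finite + 'm::finite)^'n" and L :: "real^'p^'p"
    and xi gamma :: real
    and y z s :: "nat \<Rightarrow> real^'n" and ystar zstar sstar :: "real^'n"
  assumes H: "pos_def H"
    and blk: "\<And>i. blk i \<in> {1..N}"
    and P: "\<And>k i. k \<in> {1..N} \<Longrightarrow> i \<in> {1..mk k} \<Longrightarrow>
              polyhedron (P k i) \<and> P k i \<subseteq> block_space blk k"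
    and Z: "Z = prod_of_unions blk N mk P"
    and dim: "CARD('p) = CARD('n) - CARD('m)"
    and rank_A: "rank A = CARD('m)"
    and rank_V: "rank V = CARD('p)"
    and E: "E = {x. A *v x = b}"
    and E_param: "E = {V *v v + vbar | v. True}"
    and feasible: "E \<inter> Z \<noteq> {}"
    and R: "R = R_mat H V"
    and M: "M = M_mat xi R"
    and c: "c = c_vec xi R H h vbar"
    and xi: "xi > 1 / lambda_min_pos R"
    and eig: "eigendecomposition M Q L"
    and W: "W = W_mat Q L"
    and gamma: "0 < gamma" "gamma < 1"
    and z_step: "\<And>j. z (Suc j) = M *v s j + c"
    and y_step: "\<And>j. y (Suc j) \<in> proj_set Z (s j)"
    and s_step: "\<And>j. s (Suc j) = s j - gamma *\<^sub>R (W *v (z (Suc j) - y (Suc j)))"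
    and lim: "(\<lambda>j. (y j, z j, s j)) \<longlonglongrightarrow> (ystar, zstar, sstar)"
  shows "ystar = zstar
       \<and> local_minimum (quad_obj H h) (E \<inter> Z) zstar
       \<and> regular_KKT_point H h E Z (zstar, xi *\<^sub>R (zstar - sstar))"
proof -
  have y: "y \<longlonglongrightarrow> ystar" and z: "z \<longlonglongrightarrow> zstar" and s: "s \<longlonglongrightarrow> sstar"
    using tendsto_fst[OF lim] tendsto_fst[OF tendsto_snd[OF lim]] tendsto_snd[OF tendsto_snd[OF lim]]
    by simp_all
  note Sy = LIMSEQ_Suc[OF y] and Sz = LIMSEQ_Suc[OF z] and Ss = LIMSEQ_Suc[OF s]
  have mv: "(\<lambda>j. B *v x j) \<longlonglongrightarrow> B *v x0" if "x \<longlonglongrightarrow> x0" for B :: "real^'n^'n" and x x0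
    using that by (intro bounded_linear.tendsto[OF matrix_vector_mul_bounded_linear])
  have symH: "transpose H = H" using H by (simp add: pos_def_def)
  have PP: "closed (P k i) \<and> convex (P k i)" if "k \<in> {1..N}" "i \<in> {1..mk k}" for k i
    using P[OF that] polyhedron_imp_closed polyhedron_imp_convex by blast

  \<comment> \<open>Both sides of the update of \<open>s\<close> converge, and \<open>gamma\<close> is not zero.\<close>
  have "(\<lambda>j. s (Suc j)) \<longlonglongrightarrow> sstar - gamma *\<^sub>R (W *v (zstar - ystar))"
    unfolding s_step by (intro tendsto_intros mv s Sz Sy)
  hence "W *v (zstar - ystar) = 0"
    using LIMSEQ_unique[OF Ss, of "sstar - gamma *\<^sub>R (W *v (zstar - ystar))"] gamma by simp
  hence yz: "ystar = zstar"
    using W_mat_injective[of Q L "zstar - ystar"] eig unfolding W eigendecomposition_def by simp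

  have "(\<lambda>j. z (Suc j)) \<longlonglongrightarrow> M *v sstar + c"
    unfolding z_step by (intro tendsto_intros mv s)
  hence fixed: "zstar = M *v sstar + c" using LIMSEQ_unique[OF Sz] by blast
  have proj: "zstar \<in> proj_set Z sstar"
    using proj_set_limit[OF _ y_step Sy s] closed_prod_of_unions PP unfolding yz Z by blast
  hence zZ: "zstar \<in> Z" by (simp add: mem_proj_set_iff)

  define lam where "lam = xi *\<^sub>R (zstar - sstar)"
  have neg_lam: "- lam = xi *\<^sub>R (sstar - zstar)"
    by (simp add: lam_def flip: scaleR_minus_right)
  have xi0: "0 < xi" using R_mat_shift_invertible(2) H rank_V xi unfolding R by blast
  note opt = affine_step_fixed_point[OF H rank_V xi[unfolded R] fixed[unfolded M c R]]
  have zE: "zstar \<in> E" using opt(1) by (auto simp: E_param)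
  have stat: "(H *v zstar + h - lam) \<bullet> (u - zstar) = 0" if uE: "u \<in> E" for u
  proof -
    obtain w w' where "u = V *v w + vbar" "zstar = V *v w' + vbar"
      using uE opt(1) unfolding E_param by blast
    hence "u - zstar = V *v (w - w')" by (simp add: matrix_vector_mult_diff_distrib)
    moreover have "(H *v zstar + h - lam) v* V = 0"
      using opt(2) by (simp only: lam_def transpose_matrix_vector)
    ultimately show ?thesis by (metis dot_lmul_matrix inner_zero_left)
  qed

  have "lam - h - H *v zstar \<in> regular_normal_cone E zstar"
  proof (rule regular_normal_coneI_proximal[OF zE])
    fix u assume "u \<in> E"
    thus "(lam - h - H *v zstar) \<bullet> (u - zstar) \<le> 0 * (norm (u - zstar))\<^sup>2"
      using stat[of u] by (simp add: inner_diff_left inner_add_left)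
  qed
  moreover have "- lam \<in> regular_normal_cone Z zstar"
  proof (rule regular_normal_coneI_proximal[OF zZ])
    fix u assume "u \<in> Z"
    from mult_left_mono[OF proj_set_proximal[OF proj this], of xi]
    have "xi * ((sstar - zstar) \<bullet> (u - zstar)) \<le> (xi / 2) * (norm (u - zstar))\<^sup>2"
      using xi0 by simp
    thus "- lam \<bullet> (u - zstar) \<le> (xi / 2) * (norm (u - zstar))\<^sup>2"
      unfolding neg_lam inner_scaleR_left .
  qed
  ultimately have kkt: "regular_KKT_point H h E Z (zstar, lam)"
    unfolding regular_KKT_point_def prod.case mem_Collect_eq
    by (intro conjI exI[of _ "lam - h - H *v zstar"] exI[of _ "- lam"]) simp_all

  \<comment> \<open>The second order bound used for the normal cone is too weak here: it could outweigh the
     quadratic term of the objective. Near \<open>zstar\<close> the error is absent.\<close>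
  obtain e where e: "e > 0"
    and star: "\<And>u. u \<in> Z \<Longrightarrow> norm (u - zstar) \<le> e \<Longrightarrow> closed_segment zstar u \<subseteq> Z"
    using prod_of_unions_locally_star_shaped[of N mk P blk zstar] PP unfolding Z by blast
  have "quad_obj H h zstar \<le> quad_obj H h u"
    if u: "u \<in> E" "u \<in> Z" "norm (u - zstar) \<le> e" for u
  proof -
    have "xi * ((sstar - zstar) \<bullet> (u - zstar)) \<le> 0"
      using proj_set_segment_obtuse[OF proj star[OF u(2,3)]] xi0 by (simp add: mult_le_0_iff)
    hence "- lam \<bullet> (u - zstar) \<le> 0" unfolding neg_lam inner_scaleR_left .
    hence "0 \<le> lam \<bullet> (u - zstar)" by simp
    moreover have "0 \<le> (u - zstar) \<bullet> (H *v (u - zstar))"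
      using H by (cases "u = zstar") (auto simp: pos_def_def less_imp_le)
    ultimately show ?thesis
      using stat[OF u(1)] quad_obj_expand[OF symH, of h u zstar]
      by (simp add: inner_diff_left inner_add_left)
  qed
  hence "local_minimum (quad_obj H h) (E \<inter> Z) zstar"
    unfolding local_minimum_def is_arg_min_def using zE zZ e by (auto simp: not_less)
  with yz kkt show ?thesis by (simp add: lam_def)
qed

end
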